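(* Let $(\Omega,\Sigma,P)$ be a probability space, $N=\{N_t\}_{t\in\mathbb{R}_+}$ a counting process on it, and $\bar\Theta$ a real-valued random variable on $\Omega$ such that $N$ is a $P$-MPP$(\bar\Theta)$. Suppose that $\{R_{\bar\theta}\}_{\bar\theta\in\mathbb{R}}$ is a disintegration of $P$ over $P_{\bar\Theta}$ consistent with $\bar\Theta$. Then $N$ is a $P$-MPP$(\{R_{\bar\theta}\}_{\bar\theta\in\mathbb{R}},P_{\bar\Theta})$.
   Context: Notation: $P_X$ is the law of $X$ under $P$, and $(R)_X$ the law of $X$ under a probability measure $R$ on $\Sigma$. Disintegration: a family $\{R_{\bar\theta}\}_{\bar\theta\in\mathbb{R}}$ of probability measures on $\Sigma$ is a disintegration of $P$ over $P_{\bar\Theta}$ if $\bar\theta\mapsto R_{\bar\theta}(A)$ is Borel measurable and $\int R_{\bar\theta}(A)\,P_{\bar\Theta}(d\bar\theta)=P(A)$ for every $A\in\Sigma$. It is consistent with $\bar\Theta$ if for each Borel $B\subseteq\mathbb{R}$ one has $R_{\bar\theta}(\bar\Theta^{-1}(B))=1$ for $P_{\bar\Theta}$-almost every $\bar\theta\in B$. Counting process: a family $N=\{N_t\}_{t\ge0}$ of random variables with values in $\mathbb{N}_0\cup\{\infty\}$ whose paths are right-continuous, have jumps of size at most one, vanish at $t=0$ and increase to infinity (these path properties are assumed to hold for every $\omega\in\Omega$). Arrival process: $T_0:=0$, $T_n:=\inf\{t\ge0:N_t=n\}$. Interarrival process: $W_n:=T_n-T_{n-1}$, $n\in\mathbb{N}$.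 $P$-MPP$(\bar\Theta)$ (mixed Poisson process with mixing parameter $\bar\Theta$): $P(\bar\Theta\in(0,\infty))=1$, $N$ has $P$-conditionally independent increments given $\bar\Theta$ and, for all $t\ge0$, $s>0$, the conditional distribution of $N_{t+s}-N_t$ given $\bar\Theta$ is $P$-a.s. the Poisson distribution with parameter $s\bar\Theta$. Mixed Poisson process in Huang's sense: let $\{P_y\}_{y\in\mathbb{R}}$ be probability measures on $\Sigma$ with $y\mapsto P_y(E)$ Borel measurable for every $E\in\Sigma$, and $\nu$ a Borel probability measure on $\mathbb{R}$. $N$ is a $P$-MRP$(\{P_y\}_{y\in\mathbb{R}},\nu)$ if $P\bigl(\bigcap_{k=1}^r\{W_k\le w_k\}\bigr)=\int\prod_{k=1}^r P_y(\{W_k\le w_k\})\,\nu(dy)$ for all $r\in\mathbb{N}$ and $w_1,\dots,w_r>0$. It is a $P$-MPP$(\{P_y\}_{y\in\mathbb{R}},\nu)$ if moreover there is a positive measurable function $\alpha$ on $\mathbb{R}$ such that for $\nu$-almost all $y$ and all $n\in\mathbb{N}$, $(P_y)_{W_n}$ is the exponential distribution with parameter $\alpha(y)$. *)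

theory Defs
  imports "HOL-Probability.Probability"
begin

section \<open>Counting processes\<close>

text \<open>
  A process is a function of type \<open>real \<Rightarrow> 'a \<Rightarrow> enat\<close>; only its values at times \<open>t \<ge> 0\<close> matter.
  In the jump condition the left limit \<open>l\<close> exists because paths are nondecreasing; writing
  \<open>N t \<omega> \<le> l + 1\<close> avoids the difference \<open>N t \<omega> - l\<close>, and still allows a path to reach
  infinity continuously in finite time.
\<close>

definition counting_process :: "'a measure \<Rightarrow> (real \<Rightarrow> 'a \<Rightarrow> enat) \<Rightarrow> bool" where
  "counting_process M N \<longleftrightarrow>
     (\<forall>t\<ge>0. N t \<in> M \<rightarrow>\<^sub>M count_space UNIV) \<and>
     (\<forall>\<omega>\<in>space M.
        N 0 \<omega> = 0 \<and>
        (\<forall>t\<ge>0. continuous (at_right t) (\<lambda>s. N s \<omega>)) \<and>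
        (\<forall>t>0. \<exists>l. ((\<lambda>s. N s \<omega>) \<longlongrightarrow> l) (at_left t) \<and> N t \<omega> \<le> l + 1) \<and>
        mono_on {0..} (\<lambda>t. N t \<omega>) \<and>
        ((\<lambda>t. N t \<omega>) \<longlongrightarrow> \<infinity>) at_top)"

text \<open>
  For a counting process every level \<open>n\<close> is attained, so the infimum below is that of a
  nonempty set of nonnegative reals.
\<close>

definition arrival :: "(real \<Rightarrow> 'a \<Rightarrow> enat) \<Rightarrow> nat \<Rightarrow> 'a \<Rightarrow> real" where
  "arrival N n \<omega> = (if n = 0 then 0 else Inf {t. 0 \<le> t \<and> N t \<omega> = enat n})"

text \<open>Only the indices \<open>n \<ge> 1\<close> are meaningful.\<close>

definition interarrival :: "(real \<Rightarrow> 'a \<Rightarrow> enat) \<Rightarrow> nat \<Rightarrow> 'a \<Rightarrow> real" where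
  "interarrival N n \<omega> = arrival N n \<omega> - arrival N (n - 1) \<omega>"

section \<open>Mixed Poisson processes with mixing parameter\<close>

definition gen_subalgebra :: "'a measure \<Rightarrow> ('a \<Rightarrow> real) \<Rightarrow> 'a measure" where
  "gen_subalgebra M \<Theta> = vimage_algebra (space M) \<Theta> borel"

definition cond_prob_given :: "'a measure \<Rightarrow> ('a \<Rightarrow> real) \<Rightarrow> 'a set \<Rightarrow> 'a \<Rightarrow> real" where
  "cond_prob_given M \<Theta> A = real_cond_exp M (gen_subalgebra M \<Theta>) (indicator A)"

definition cond_indep_vars ::
  "'a measure \<Rightarrow> ('a \<Rightarrow> real) \<Rightarrow> ('i \<Rightarrow> 'b measure) \<Rightarrow> ('i \<Rightarrow> 'a \<Rightarrow> 'b) \<Rightarrow> 'i set \<Rightarrow> bool" where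
  "cond_indep_vars M \<Theta> M' X I \<longleftrightarrow>
     (\<forall>i\<in>I. X i \<in> M \<rightarrow>\<^sub>M M' i) \<and>
     (\<forall>J\<subseteq>I. J \<noteq> {} \<longrightarrow> finite J \<longrightarrow>
        (\<forall>B. (\<forall>j\<in>J. B j \<in> sets (M' j)) \<longrightarrow>
           (AE \<omega> in M. cond_prob_given M \<Theta> (\<Inter>j\<in>J. X j -` B j \<inter> space M) \<omega> =
              (\<Prod>j\<in>J. cond_prob_given M \<Theta> (X j -` B j \<inter> space M) \<omega>))))"

text \<open>
  The differences are those of \<^typ>\<open>enat\<close>, where \<open>\<infinity> - \<infinity> = \<infinity>\<close>. In the definition of
  \<open>mixed_poisson_process\<close> this convention is immaterial: the Poisson condition makes each
  \<open>N t\<close> almost surely finite.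
\<close>

definition cond_indep_increments :: "'a measure \<Rightarrow> (real \<Rightarrow> 'a \<Rightarrow> enat) \<Rightarrow> ('a \<Rightarrow> real) \<Rightarrow> bool" where
  "cond_indep_increments M N \<Theta> \<longleftrightarrow>
     (\<forall>m (t :: nat \<Rightarrow> real). 0 \<le> t 0 \<longrightarrow> strict_mono_on {0..m} t \<longrightarrow>
        cond_indep_vars M \<Theta> (\<lambda>_. count_space UNIV)
          (\<lambda>j \<omega>. N (t j) \<omega> - N (t (j - 1)) \<omega>) {1..m})"

text \<open>
  The library's \<open>poisson_pmf\<close> is specified for positive rates only, so the value of the right-hand
  side in the last clause is determined only where \<open>\<Theta> \<omega> > 0\<close>, that is, almost everywhere by
  the first clause.
\<close>

definition mixed_poisson_process :: "'a measure \<Rightarrow> (real \<Rightarrow> 'a \<Rightarrow> enat) \<Rightarrow> ('a \<Rightarrow> real) \<Rightarrow> bool" where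
  "mixed_poisson_process M N \<Theta> \<longleftrightarrow>
     measure M {\<omega> \<in> space M. 0 < \<Theta> \<omega>} = 1 \<and>
     cond_indep_increments M N \<Theta> \<and>
     (\<forall>t\<ge>0. \<forall>s>0. \<forall>B :: enat set.
        AE \<omega> in M. cond_prob_given M \<Theta> {\<omega>' \<in> space M. N (t + s) \<omega>' - N t \<omega>' \<in> B} \<omega> =
          measure_pmf.prob (map_pmf enat (poisson_pmf (s * \<Theta> \<omega>))) B)"

section \<open>Disintegrations\<close>

text \<open>
  Membership in \<open>borel \<rightarrow>\<^sub>M prob_algebra M\<close> says that every \<open>R \<theta>\<close> is a probability measure on
  the sigma-algebra of \<open>M\<close> and that \<open>\<theta> \<mapsto> R \<theta> A\<close> is Borel measurable for each measurable \<open>A\<close>.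
\<close>

definition disintegration :: "'a measure \<Rightarrow> (real \<Rightarrow> 'a measure) \<Rightarrow> real measure \<Rightarrow> bool" where
  "disintegration M R \<nu> \<longleftrightarrow>
     R \<in> borel \<rightarrow>\<^sub>M prob_algebra M \<and>
     (\<forall>A\<in>sets M. (\<integral>\<^sup>+\<theta>. emeasure (R \<theta>) A \<partial>\<nu>) = emeasure M A)"

definition consistent_with :: "'a measure \<Rightarrow> (real \<Rightarrow> 'a measure) \<Rightarrow> ('a \<Rightarrow> real) \<Rightarrow> bool" where
  "consistent_with M R \<Theta> \<longleftrightarrow>
     (\<forall>B\<in>sets borel. AE \<theta> in distr M borel \<Theta>. \<theta> \<in> B \<longrightarrow> measure (R \<theta>) (\<Theta> -` B \<inter> space M) = 1)"

section \<open>Mixed renewal and mixed Poisson processes in Huang's sense\<close>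

definition huang_mrp ::
  "'a measure \<Rightarrow> (real \<Rightarrow> 'a \<Rightarrow> enat) \<Rightarrow> (real \<Rightarrow> 'a measure) \<Rightarrow> real measure \<Rightarrow> bool" where
  "huang_mrp M N P \<nu> \<longleftrightarrow>
     P \<in> borel \<rightarrow>\<^sub>M prob_algebra M \<and> prob_space \<nu> \<and> sets \<nu> = sets borel \<and>
     (\<forall>r\<ge>1. \<forall>w :: nat \<Rightarrow> real. (\<forall>k\<in>{1..r}. 0 < w k) \<longrightarrow>
        measure M (\<Inter>k\<in>{1..r}. {\<omega> \<in> space M. interarrival N k \<omega> \<le> w k}) =
          (\<integral>y. (\<Prod>k\<in>{1..r}. measure (P y) {\<omega> \<in> space M. interarrival N k \<omega> \<le> w k}) \<partial>\<nu>))"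

definition huang_mpp ::
  "'a measure \<Rightarrow> (real \<Rightarrow> 'a \<Rightarrow> enat) \<Rightarrow> (real \<Rightarrow> 'a measure) \<Rightarrow> real measure \<Rightarrow> bool" where
  "huang_mpp M N P \<nu> \<longleftrightarrow>
     huang_mrp M N P \<nu> \<and>
     (\<exists>\<alpha> :: real \<Rightarrow> real. \<alpha> \<in> borel_measurable borel \<and> (\<forall>y. 0 < \<alpha> y) \<and>
        (AE y in \<nu>. \<forall>n\<ge>1. distributed (P y) lborel (interarrival N n) (exponential_density (\<alpha> y))))"

end

(*
  Both hypotheses on R together say that R (\<Theta> \<omega>) A is a version of the conditional
  probability of A given \<Theta>. Observe N only on the grid of mesh 1/m: the event that the first r
  arrivals fall in prescribed distinct cells, with no further arrival up to the end of the last of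
  these cells, is an intersection of events on the single increments, each of which equals 0 or 1.
  Its probability under R \<theta> is therefore an explicit product for almost every \<theta>, and
  summing it over the admissible gaps between the cells gives a product of geometric sums. As m
  tends to infinity, these unions of grid events converge pointwise to the event that each
  interarrival time W k is at most w k, and the products converge to the product of the exponential
  distribution functions 1 - exp (- \<theta> w k).
*)
theory Submission
  imports Defs "HOL-Real_Asymp.Real_Asymp"
begin

section \<open>Arrival times of a counting path\<close>

text \<open>The infimum is computed over \<open>{t. 0 \<le> t \<and> enat n \<le> f t}\<close>
  instead, which is nonempty because \<open>f\<close> tends to infinity. Right-continuity forces
  \<open>f\<close> to have reached \<open>n\<close> at this infimum, and the bound on jumps keeps it
  from passing above \<open>n\<close>, so the infimum lies in the level set.\<close>

lemma Inf_upcrossing: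
  fixes f :: "real \<Rightarrow> enat" and n :: nat
  assumes f0: "f 0 = 0" and mono: "mono_on {0..} f"
    and right: "\<And>t. 0 \<le> t \<Longrightarrow> continuous (at_right t) f"
    and jump: "\<And>t. 0 < t \<Longrightarrow> \<exists>l. (f \<longlongrightarrow> l) (at_left t) \<and> f t \<le> l + 1"
    and lim: "(f \<longlongrightarrow> \<infinity>) at_top" and n: "1 \<le> n"
  shows "0 < Inf {t. 0 \<le> t \<and> f t = enat n}" and "f (Inf {t. 0 \<le> t \<and> f t = enat n}) = enat n"
    and "\<And>t. 0 \<le> t \<Longrightarrow> enat n \<le> f t \<Longrightarrow> Inf {t. 0 \<le> t \<and> f t = enat n} \<le> t"
proof -
  define A where "A = {t. 0 \<le> t \<and> enat n \<le> f t}"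
  define \<tau> where "\<tau> = Inf A"
  have bdd: "bdd_below A" by (auto simp: A_def bdd_below_def)
  have "eventually (\<lambda>t. enat n < f t \<and> 0 \<le> t) at_top"
    using order_tendstoD(1)[OF lim, of "enat n"] eventually_ge_at_top[of 0]
    by (auto intro: eventually_conj)
  then obtain t where "enat n < f t \<and> 0 \<le> t"
    using eventually_happens trivial_limit_at_top_linorder by blast
  then have ne: "A \<noteq> {}" by (auto simp: A_def intro!: exI[of _ t])
  have \<tau>0: "0 \<le> \<tau>" unfolding \<tau>_def using ne by (intro cInf_greatest) (auto simp: A_def)
  have lower: "\<tau> \<le> t" if "t \<in> A" for t unfolding \<tau>_def using that bdd by (intro cInf_lower)
  have ge: "enat n \<le> f \<tau>"
  proof (rule ccontr)
    assume "\<not> ?thesis"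
    then have lt: "f \<tau> < enat n" by simp
    have "(f \<longlongrightarrow> f \<tau>) (at_right \<tau>)" using right[OF \<tau>0] by (simp add: continuous_within)
    from order_tendstoD(2)[OF this lt] obtain b where b: "\<tau> < b" "\<And>s. \<tau> < s \<Longrightarrow> s < b \<Longrightarrow> f s < enat n"
      unfolding eventually_at_right_field by auto
    obtain s where s: "s \<in> A" "s < b" using cInf_lessD[OF ne, of b] b(1) unfolding \<tau>_def by auto
    then have "\<tau> \<le> s" "enat n \<le> f s" using lower by (auto simp: A_def)
    then show False using b(2)[of s] s(2) lt by (cases "s = \<tau>") auto
  qed
  have "\<tau> \<noteq> 0" using ge f0 n by (auto simp: zero_enat_def)
  then have \<tau>pos: "0 < \<tau>" using \<tau>0 by simp
  obtain l where l: "(f \<longlongrightarrow> l) (at_left \<tau>)" "f \<tau> \<le> l + 1" using jump[OF \<tau>pos] by auto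
  \<comment> \<open>Before \<open>\<tau>\<close> the values are below \<open>n\<close>, hence at
    most \<open>n - 1\<close>; the left limit inherits this bound, and the jump adds at most
    one.\<close>
  have "eventually (\<lambda>s. f s \<le> enat (n - 1)) (at_left \<tau>)"
    unfolding eventually_at_left_field
  proof (intro exI[of _ 0] conjI allI impI \<tau>pos)
    fix s assume s: "0 < s" "s < \<tau>"
    then have "\<not> enat n \<le> f s" using lower[of s] by (auto simp: A_def)
    then show "f s \<le> enat (n - 1)" by (cases "f s") auto
  qed
  from tendsto_upperbound[OF l(1) this] have "l \<le> enat (n - 1)" by simp
  then have "l + 1 \<le> enat n" using n by (cases l) (auto simp: one_enat_def)
  with l(2) ge have eq: "f \<tau> = enat n" by simp
  have "Inf {t. 0 \<le> t \<and> f t = enat n} = \<tau>"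
    by (rule cInf_eq_minimum) (use \<tau>0 eq lower in \<open>auto simp: A_def\<close>)
  then show "0 < Inf {t. 0 \<le> t \<and> f t = enat n}" "f (Inf {t. 0 \<le> t \<and> f t = enat n}) = enat n"
    and "\<And>t. 0 \<le> t \<Longrightarrow> enat n \<le> f t \<Longrightarrow> Inf {t. 0 \<le> t \<and> f t = enat n} \<le> t"
    using \<tau>pos eq lower by (auto simp: A_def)
qed

context
  fixes M :: "'a measure" and N :: "real \<Rightarrow> 'a \<Rightarrow> enat"
  assumes cp: "counting_process M N"
begin

lemma measurable_counting [measurable]: "0 \<le> t \<Longrightarrow> N t \<in> M \<rightarrow>\<^sub>M count_space UNIV"
  using cp by (auto simp: counting_process_def)

lemma counting_0: "\<omega> \<in> space M \<Longrightarrow> N 0 \<omega> = 0"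
  using cp by (auto simp: counting_process_def)

lemma counting_mono: "\<omega> \<in> space M \<Longrightarrow> 0 \<le> s \<Longrightarrow> s \<le> t \<Longrightarrow> N s \<omega> \<le> N t \<omega>"
  using cp by (auto simp: counting_process_def mono_on_def)

text \<open>The last equivalence is the duality between arrival times and counts, which turns
  statements on arrivals into statements on \<open>N\<close> at fixed times.\<close>

lemma
  assumes "\<omega> \<in> space M"
  shows arrival_nonneg: "0 \<le> arrival N n \<omega>"
    and counting_arrival: "N (arrival N n \<omega>) \<omega> = enat n"
    and arrival_le_iff: "0 \<le> t \<Longrightarrow> arrival N n \<omega> \<le> t \<longleftrightarrow> enat n \<le> N t \<omega>"
proof -
  have "0 \<le> arrival N n \<omega> \<and> N (arrival N n \<omega>) \<omega> = enat n \<and>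
    (\<forall>t. 0 \<le> t \<longrightarrow> enat n \<le> N t \<omega> \<longrightarrow> arrival N n \<omega> \<le> t)"
  proof (cases "n = 0")
    case False
    then show ?thesis
      using Inf_upcrossing[of "\<lambda>t. N t \<omega>" n] cp assms
      by (simp add: counting_process_def arrival_def less_imp_le)
  qed (use counting_0[OF assms] in \<open>simp add: arrival_def zero_enat_def\<close>)
  moreover have "enat n \<le> N t \<omega>" if "arrival N n \<omega> \<le> t" for t
    using calculation counting_mono[OF assms, of "arrival N n \<omega>" t] that by auto
  ultimately show "0 \<le> arrival N n \<omega>" "N (arrival N n \<omega>) \<omega> = enat n"
    "0 \<le> t \<Longrightarrow> arrival N n \<omega> \<le> t \<longleftrightarrow> enat n \<le> N t \<omega>" by blast+
qed

lemma arrival_strict_mono: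
  assumes "\<omega> \<in> space M" "m < n"
  shows "arrival N m \<omega> < arrival N n \<omega>"
  using arrival_le_iff[OF assms(1) arrival_nonneg[OF assms(1)], of n m] counting_arrival[OF assms(1), of m] assms(2)
  by (simp add: not_le[symmetric])

lemma measurable_arrival [measurable]: "arrival N n \<in> borel_measurable M"
  unfolding borel_measurable_iff_le
proof
  fix a :: real
  show "{\<omega> \<in> space M. arrival N n \<omega> \<le> a} \<in> sets M"
  proof (cases "0 \<le> a")
    case True
    then have "{\<omega> \<in> space M. arrival N n \<omega> \<le> a} = N a -` {enat n..} \<inter> space M"
      using arrival_le_iff by auto
    then show ?thesis using measurable_counting[OF True] by (simp add: measurable_sets)
  next
    case False
    then have "{\<omega> \<in> space M. arrival N n \<omega> \<le> a} = {}" 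
      using arrival_nonneg by (auto simp: not_le intro: less_le_trans)
    then show ?thesis by (simp only: sets.empty_sets)
  qed
qed

lemma measurable_interarrival [measurable]: "interarrival N n \<in> borel_measurable M"
  unfolding interarrival_def by measurable

end

section \<open>Arrivals observed on a grid\<close>

text \<open>Splits off the last block of cells in the two inductions on the number of
  arrivals.\<close>

lemma image_Suc_iff:
  fixes i :: "nat \<Rightarrow> nat"
  assumes inc: "\<And>k. k \<le> r \<Longrightarrow> i k < i (Suc k)"
  shows "j \<in> i ` {1..Suc r} \<longleftrightarrow> (if j \<le> i r then j \<in> i ` {1..r} else j = i (Suc r))"
proof -
  have imono: "i k \<le> i l" if "k \<le> l" "l \<le> Suc r" for k l
    using that by (induction l) (auto simp: le_Suc_eq intro: order.trans[OF _ less_imp_le[OF inc]])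
  have "i k \<le> i r" if "k \<in> {1..r}" for k using imono that by simp
  then show ?thesis using inc[of r] by (auto simp: atLeastAtMostSuc_conv)
qed

text \<open>\<open>n j\<close> stands for the count at grid point \<open>j\<close>, and the
  hypothesis on \<open>S\<close> makes \<open>S k\<close> the first grid point where the count is at
  least \<open>k\<close>. Induction on \<open>r\<close> adds the cells after \<open>i r\<close> up
  to \<open>i (Suc r)\<close>: zeros keep the count at \<open>r\<close>, and the final one raises it
  to \<open>Suc r\<close>. The clause \<open>i r < S (Suc r)\<close> excludes a further arrival up
  to grid point \<open>i r\<close>.\<close>

lemma unit_increments_iff:
  fixes n :: "nat \<Rightarrow> enat" and S i :: "nat \<Rightarrow> nat"
  assumes n0: "n 0 = 0" and mono: "\<And>j k. j \<le> k \<Longrightarrow> n j \<le> n k"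
    and S: "\<And>k j. S k \<le> j \<longleftrightarrow> enat k \<le> n j"
    and i0: "i 0 = 0" and inc: "\<And>k. k < r \<Longrightarrow> i k < i (Suc k)"
  shows "(\<forall>j\<in>{1..i r}. n j - n (j - 1) = (if j \<in> i ` {1..r} then 1 else 0)) \<longleftrightarrow>
    (\<forall>k\<in>{1..r}. S k = i k) \<and> i r < S (Suc r)"
  using inc
proof (induction r)
  case 0
  have "\<not> S 1 \<le> 0" unfolding S n0 by (simp add: zero_enat_def)
  then show ?case by (simp add: i0)
next
  case (Suc r)
  have inc: "i k < i (Suc k)" if "k \<le> r" for k using Suc.prems that by simp
  note mem = image_Suc_iff[of r i, OF inc]
  have split: "{1..i (Suc r)} = {1..i r} \<union> {i r<..i (Suc r)}" using inc[of r] by auto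
  have "(\<forall>j\<in>{1..i (Suc r)}. n j - n (j - 1) = (if j \<in> i ` {1..Suc r} then 1 else 0)) \<longleftrightarrow>
    (\<forall>j\<in>{1..i r}. n j - n (j - 1) = (if j \<in> i ` {1..r} then 1 else 0)) \<and>
    (\<forall>j\<in>{i r<..i (Suc r)}. n j - n (j - 1) = (if j = i (Suc r) then 1 else 0))"
    unfolding split ball_Un using mem by (intro arg_cong2[of _ _ _ _ "(\<and>)"] ball_cong refl) auto
  also have "\<dots> \<longleftrightarrow> ((\<forall>k\<in>{1..r}. S k = i k) \<and> i r < S (Suc r)) \<and>
    (\<forall>j\<in>{i r<..i (Suc r)}. n j - n (j - 1) = (if j = i (Suc r) then 1 else 0))"
    using Suc.IH inc by simp
  also have "\<dots> \<longleftrightarrow> ((\<forall>k\<in>{1..r}. S k = i k) \<and> i r < S (Suc r)) \<and> S (Suc r) = i (Suc r) \<and> i (Suc r) < S (Suc (Suc r))"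
  proof (intro conj_cong refl)
    assume H: "(\<forall>k\<in>{1..r}. S k = i k) \<and> i r < S (Suc r)"
    have nr: "n (i r) = enat r"
    proof (rule antisym)
      show "enat r \<le> n (i r)" using H S[of r "i r"] by (cases r) (auto simp: i0 zero_enat_def[symmetric])
      show "n (i r) \<le> enat r" using H S[of "Suc r" "i r"] by (cases "n (i r)") auto
    qed
    show "(\<forall>j\<in>{i r<..i (Suc r)}. n j - n (j - 1) = (if j = i (Suc r) then 1 else 0)) \<longleftrightarrow>
      S (Suc r) = i (Suc r) \<and> i (Suc r) < S (Suc (Suc r))" (is "?L \<longleftrightarrow> ?R")
    proof
      assume L: ?L
      have const: "n j = enat r" if "i r \<le> j" "j < i (Suc r)" for j
        using that
      proof (induction j rule: dec_induct)
        case base show ?case by (rule nr)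
      next
        case (step j)
        then have "n (Suc j) - n j = 0" using L by (force dest: bspec[of _ _ "Suc j"])
        \<comment> \<open>Subtraction truncates at zero, so a vanishing difference only says that
          the count does not exceed \<open>r\<close>; monotonicity supplies equality.\<close>
        with step mono[of j "Suc j"] show ?case by (cases "n (Suc j)") (auto simp: zero_enat_def)
      qed
      obtain j where j: "i (Suc r) = Suc j" using inc[of r] by (cases "i (Suc r)") auto
      then have nj: "n j = enat r" using const inc[of r] by simp
      have "n (Suc j) - n j = 1" using L j inc[of r] by (auto dest: bspec[of _ _ "Suc j"])
      then have nSj: "n (Suc j) = enat (Suc r)" using nj mono[of j "Suc j"]
        by (cases "n (Suc j)") (auto simp: one_enat_def)
      have "S (Suc r) \<le> Suc j" "\<not> S (Suc r) \<le> j" "\<not> S (Suc (Suc r)) \<le> Suc j"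
        unfolding S nj nSj by auto
      then show ?R using j by auto
    next
      assume R: ?R
      have const: "n j = enat r" if "i r \<le> j" "j < i (Suc r)" for j
        using S[of "Suc r" j] mono[OF that(1)] nr R that(2) by (cases "n j") auto
      have "enat (Suc r) \<le> n (i (Suc r))" "\<not> enat (Suc (Suc r)) \<le> n (i (Suc r))"
        unfolding S[symmetric] using R by auto
      then have "n (i (Suc r)) = enat (Suc r)" by (cases "n (i (Suc r))") auto
      then show ?L using const[of "_ - 1"] const by (auto simp: one_enat_def zero_enat_def)
    qed
  qed
  also have "\<dots> \<longleftrightarrow> (\<forall>k\<in>{1..Suc r}. S k = i k) \<and> i (Suc r) < S (Suc (Suc r))"
    using inc[of r] by (auto simp: atLeastAtMostSuc_conv)
  finally show ?case .
qed


lemma measurable_increment: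
  assumes "counting_process M N" "0 \<le> s" "0 \<le> t"
  shows "(\<lambda>\<omega>. N t \<omega> - N s \<omega>) \<in> M \<rightarrow>\<^sub>M count_space UNIV"
proof (rule measurable_compose_countable[where f = "\<lambda>i \<omega>. i - N s \<omega>"])
  show "(\<lambda>\<omega>. i - N s \<omega>) \<in> M \<rightarrow>\<^sub>M count_space UNIV" for i
    using measurable_counting[OF assms(1,2)] by (rule measurable_compose) simp
qed (use measurable_counting[OF assms(1,3)] in simp)

text \<open>Cell \<open>j\<close> is the interval from \<open>(j - 1) / m\<close> to
  \<open>j / m\<close>, closed on the right. The parameters are the gaps \<open>g k\<close> between
  the cells of consecutive arrivals, and the partial sums of \<open>g\<close> are those cells: in
  terms of gaps the probabilities factor over \<open>k\<close>.\<close>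

definition grid_event :: "'a measure \<Rightarrow> (real \<Rightarrow> 'a \<Rightarrow> enat) \<Rightarrow> nat \<Rightarrow> nat \<Rightarrow> (nat \<Rightarrow> nat) \<Rightarrow> 'a set" where
  "grid_event M N m r g = {\<omega> \<in> space M. \<forall>j\<in>{1..\<Sum>l=1..r. g l}.
     N (real j / real m) \<omega> - N (real (j - 1) / real m) \<omega> =
       (if j \<in> (\<lambda>k. \<Sum>l=1..k. g l) ` {1..r} then 1 else 0)}"

text \<open>The ceiling gives the index of the cell containing the arrival, because cells are closed
  on the right.\<close>

definition grid_arrival :: "(real \<Rightarrow> 'a \<Rightarrow> enat) \<Rightarrow> nat \<Rightarrow> nat \<Rightarrow> 'a \<Rightarrow> nat" where
  "grid_arrival N m k \<omega> = nat \<lceil>real m * arrival N k \<omega>\<rceil>"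

lemma grid_arrival_0 [simp]: "grid_arrival N m 0 \<omega> = 0"
  by (simp add: grid_arrival_def arrival_def)

text \<open>By duality, \<open>grid_arrival N m k \<omega> \<le> j\<close> says that the count has
  reached \<open>k\<close> at time \<open>j / m\<close>, so \<open>unit_increments_iff\<close>
  applies.\<close>

lemma grid_event_iff:
  assumes cp: "counting_process M N" and \<omega>: "\<omega> \<in> space M" and m: "0 < m"
    and g: "\<And>k. k \<in> {1..r} \<Longrightarrow> 1 \<le> g k"
  shows "\<omega> \<in> grid_event M N m r g \<longleftrightarrow>
    (\<forall>k\<in>{1..r}. grid_arrival N m k \<omega> = (\<Sum>l=1..k. g l)) \<and> (\<Sum>l=1..r. g l) < grid_arrival N m (Suc r) \<omega>"
proof -
  have "grid_arrival N m k \<omega> \<le> j \<longleftrightarrow> enat k \<le> N (real j / real m) \<omega>" for k j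
  proof -
    have "grid_arrival N m k \<omega> \<le> j \<longleftrightarrow> arrival N k \<omega> \<le> real j / real m"
      using m by (simp add: grid_arrival_def nat_le_iff ceiling_le_iff field_simps)
    then show ?thesis using arrival_le_iff[OF cp \<omega>] by simp
  qed
  then show ?thesis
    using unit_increments_iff[of "\<lambda>j. N (real j / real m) \<omega>" "\<lambda>k. grid_arrival N m k \<omega>"
        "\<lambda>k. \<Sum>l=1..k. g l" r] g counting_0[OF cp \<omega>]
      counting_mono[OF cp \<omega>] \<omega> m
    by (simp add: grid_event_def divide_right_mono Suc_le_eq)
qed

text \<open>The gaps can be read off from the path. This makes grid events with different gaps
  disjoint and ties each gap to an interarrival time up to rounding.\<close>

lemma grid_event_gap:
  assumes cp: "counting_process M N" and \<omega>: "\<omega> \<in> grid_event M N m r g" and m: "0 < m"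
    and g: "\<And>k. k \<in> {1..r} \<Longrightarrow> 1 \<le> g k" and k: "k \<in> {1..r}"
  shows "g k = grid_arrival N m k \<omega> - grid_arrival N m (k - 1) \<omega>"
    and "grid_arrival N m (k - 1) \<omega> \<le> grid_arrival N m k \<omega>"
proof -
  have "\<omega> \<in> space M" using \<omega> by (simp add: grid_event_def)
  with \<omega> have S: "grid_arrival N m k \<omega> = (\<Sum>l=1..k. g l)" if "k \<le> r" for k
    using grid_event_iff[of M N \<omega> m r g] cp m g that by (cases "k = 0") auto
  have "{1..k} = insert k {1..k - 1}" using k by auto
  then have "(\<Sum>l=1..k. g l) = g k + (\<Sum>l=1..k-1. g l)"
    by (subst sum.insert[symmetric]) (use k in auto)
  then show "g k = grid_arrival N m k \<omega> - grid_arrival N m (k - 1) \<omega>"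
    "grid_arrival N m (k - 1) \<omega> \<le> grid_arrival N m k \<omega>"
    using S[of k] S[of "k - 1"] k by auto
qed

lemma grid_event_sets [measurable]:
  assumes "counting_process M N"
  shows "grid_event M N m r g \<in> sets M"
proof -
  note [measurable] = measurable_increment[OF assms]
  show ?thesis unfolding grid_event_def by measurable
qed

text \<open>
  The bound exceeds \<open>m * w k\<close> by more than the rounding error of a gap, so that the events below
  converge even on paths with \<open>W k = w k\<close>.
\<close>

definition grid_gaps :: "(nat \<Rightarrow> real) \<Rightarrow> nat \<Rightarrow> nat \<Rightarrow> (nat \<Rightarrow> nat) set" where
  "grid_gaps w m r = PiE {1..r} (\<lambda>k. {1..nat \<lfloor>real m * w k\<rfloor> + 2})"

lemma finite_grid_gaps: "finite (grid_gaps w m r)"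
  unfolding grid_gaps_def by (rule finite_PiE) auto

section \<open>The limit of vanishing mesh\<close>

lemma eventually_mult_gt: "0 < (d::real) \<Longrightarrow> eventually (\<lambda>m. c < real m * d) sequentially"
  by real_asymp

text \<open>For a fixed path the mesh is eventually so fine that the first \<open>Suc r\<close>
  arrivals lie in distinct cells and every interarrival time above its bound exceeds it by several
  cells. Rounding then cannot change which bounds hold.\<close>

lemma eventually_Union_grid_event_iff:
  assumes cp: "counting_process M N" and \<omega>: "\<omega> \<in> space M" and w: "\<And>k. k \<in> {1..r} \<Longrightarrow> 0 < w k"
  shows "eventually (\<lambda>m. \<omega> \<in> (\<Union>g\<in>grid_gaps w m r. grid_event M N m r g) \<longleftrightarrow>
    (\<forall>k\<in>{1..r}. interarrival N k \<omega> \<le> w k)) sequentially"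
proof -
  let ?T = "\<lambda>k. arrival N k \<omega>"
  \<comment> \<open>The range includes \<open>r\<close> because a grid event also requires arrival
    \<open>Suc r\<close> to lie in a later cell than arrival \<open>r\<close>.\<close>
  have "eventually (\<lambda>m. \<forall>k\<in>{..r}. 1 < real m * (?T (Suc k) - ?T k)) sequentially"
    using arrival_strict_mono[OF cp \<omega>] by (intro eventually_ball_finite ballI eventually_mult_gt) auto
  \<comment> \<open>Three cells: two for the slack in \<open>grid_gaps\<close> and one for the
    rounding error of a gap.\<close>
  moreover have "eventually (\<lambda>m. \<forall>k\<in>{1..r}. w k < interarrival N k \<omega> \<longrightarrow> 3 < real m * (interarrival N k \<omega> - w k)) sequentially"
    by (intro eventually_ball_finite ballI) (auto intro: eventually_mult_gt eventually_mono)
  moreover have "eventually (\<lambda>m::nat. 0 < m) sequentially" by (rule eventually_gt_at_top)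
  ultimately show ?thesis
  proof eventually_elim
    case (elim m)
    define S where "S k = grid_arrival N m k \<omega>" for k
    have S0: "S 0 = 0" by (simp add: S_def)
    have Sb: "real m * ?T k \<le> real (S k)" "real (S k) < real m * ?T k + 1" for k
    proof -
      have "real (S k) = of_int \<lceil>real m * ?T k\<rceil>"
        using arrival_nonneg[OF cp \<omega>, of k] by (simp add: S_def grid_arrival_def)
      then show "real m * ?T k \<le> real (S k)" "real (S k) < real m * ?T k + 1" by linarith+
    qed
    have Sinc: "S k < S (Suc k)" if "k \<le> r" for k
    proof -
      have "1 < real m * ?T (Suc k) - real m * ?T k" using elim(1) that by (auto simp: algebra_simps)
      then have "real (S k) < real (S (Suc k))" using Sb[of k] Sb[of "Suc k"] by linarith
      then show ?thesis by simp
    qed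
    have Wk: "real m * interarrival N k \<omega> = real m * ?T k - real m * ?T (k - 1)" for k
      by (simp add: interarrival_def algebra_simps)
    show ?case
    proof
      assume "\<omega> \<in> (\<Union>g\<in>grid_gaps w m r. grid_event M N m r g)"
      then obtain g where g: "g \<in> grid_gaps w m r" "\<omega> \<in> grid_event M N m r g" by auto
      show "\<forall>k\<in>{1..r}. interarrival N k \<omega> \<le> w k"
      proof (intro ballI, rule ccontr)
        fix k assume k: "k \<in> {1..r}" and "\<not> interarrival N k \<omega> \<le> w k"
        then have "3 < real m * (interarrival N k \<omega> - w k)" using elim(2) by auto
        then have *: "3 < real m * interarrival N k \<omega> - real m * w k" by (simp add: algebra_simps)
        have g1: "1 \<le> g k" if "k \<in> {1..r}" for k using g(1) that by (auto simp: grid_gaps_def PiE_iff)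
        have gk: "g k \<le> nat \<lfloor>real m * w k\<rfloor> + 2" using g(1) k by (auto simp: grid_gaps_def PiE_iff)
        have "0 \<le> real m * w k" using w[OF k] by simp
        then have "real (nat \<lfloor>real m * w k\<rfloor>) \<le> real m * w k" by simp
        then have "real (g k) \<le> real m * w k + 2" using gk by linarith
        moreover have "real (g k) = real (S k) - real (S (k - 1))"
          using grid_event_gap[OF cp g(2) elim(3) g1 k] by (simp add: S_def of_nat_diff)
        ultimately show False using * Sb[of k] Sb[of "k - 1"] Wk[of k] by linarith
      qed
    next
      assume le: "\<forall>k\<in>{1..r}. interarrival N k \<omega> \<le> w k"
      define g where "g = restrict (\<lambda>k. S k - S (k - 1)) {1..r}"
      have Sk: "S (k - 1) < S k" if "k \<in> {1..r}" for k using Sinc[of "k - 1"] that by auto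
      then have g1: "1 \<le> g k" if "k \<in> {1..r}" for k using that by (fastforce simp: g_def)
      have sum_g: "(\<Sum>l=1..k. g l) = S k" if "k \<le> r" for k
        using that
      proof (induction k)
        case (Suc k)
        then show ?case using Sinc[of k] by (simp add: g_def)
      qed (simp add: S0)
      have "\<omega> \<in> grid_event M N m r g"
        using grid_event_iff[of M N \<omega> m r g] cp \<omega> elim(3) g1 sum_g Sinc[of r] by (auto simp: S_def)
      moreover have "g \<in> grid_gaps w m r"
        unfolding grid_gaps_def
      proof (rule PiE_I)
        fix k assume k: "k \<in> {1..r}"
        have "real m * interarrival N k \<omega> \<le> real m * w k" using le k by (simp add: mult_left_mono)
        moreover have "real (g k) = real (S k) - real (S (k - 1))" using k Sk[OF k] by (simp add: g_def of_nat_diff)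
        ultimately have "real (g k) < real m * w k + 1" using Sb[of k] Sb[of "k - 1"] Wk[of k] by linarith
        then have "int (g k) \<le> \<lfloor>real m * w k\<rfloor> + 2" by linarith
        then show "g k \<in> {1..nat \<lfloor>real m * w k\<rfloor> + 2}" using g1[OF k] by auto
      qed (auto simp: g_def restrict_def)
      ultimately show "\<omega> \<in> (\<Union>g\<in>grid_gaps w m r. grid_event M N m r g)" by auto
    qed
  qed
qed

text \<open>Stated for an arbitrary probability space, to be applied under each
  \<open>R \<theta>\<close> with \<open>l = \<theta>\<close>. Pathwise convergence of the unions of
  grid events gives convergence of their probabilities by dominated convergence.\<close>

lemma (in prob_space) prob_interarrival_le:
  assumes cp: "counting_process M N" and l: "0 < l" and w: "\<And>k. k \<in> {1..r} \<Longrightarrow> 0 < w k"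
    and grid: "\<And>m g. 0 < m \<Longrightarrow> g \<in> grid_gaps w m r \<Longrightarrow>
      prob (grid_event M N m r g) = (\<Prod>k=1..r. (l / m * exp (- l / m)) * exp (- l / m) ^ (g k - 1))"
  shows "prob {\<omega> \<in> space M. \<forall>k\<in>{1..r}. interarrival N k \<omega> \<le> w k} = (\<Prod>k=1..r. 1 - exp (- l * w k))"
proof -
  define E where "E m = (\<Union>g\<in>grid_gaps w m r. grid_event M N m r g)" for m
  define W where "W = {\<omega> \<in> space M. \<forall>k\<in>{1..r}. interarrival N k \<omega> \<le> w k}"
  note [measurable] = grid_event_sets[OF cp] measurable_interarrival[OF cp]
  have E_sets [measurable]: "E m \<in> sets M" for m
    unfolding E_def using finite_grid_gaps by (intro sets.finite_UN) auto
  have W_sets [measurable]: "W \<in> sets M" unfolding W_def by measurable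
  have "(\<lambda>m. expectation (indicat_real (E m))) \<longlonglongrightarrow> expectation (indicat_real W)"
  proof (rule integral_dominated_convergence[where w = "\<lambda>_. 1"])
    show "AE \<omega> in M. (\<lambda>m. indicat_real (E m) \<omega>) \<longlonglongrightarrow> indicat_real W \<omega>"
    proof (rule AE_I2)
      fix \<omega> assume \<omega>: "\<omega> \<in> space M"
      have "eventually (\<lambda>m. indicat_real (E m) \<omega> = indicat_real W \<omega>) sequentially"
        using eventually_Union_grid_event_iff[of M N \<omega> r w, OF cp \<omega>] w
        by (auto simp: E_def W_def \<omega> indicator_def elim: eventually_mono)
      then show "(\<lambda>m. indicat_real (E m) \<omega>) \<longlonglongrightarrow> indicat_real W \<omega>" by (rule tendsto_eventually)
    qed
  qed (auto simp: indicator_def)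
  then have lim1: "(\<lambda>m. prob (E m)) \<longlonglongrightarrow> prob W" by simp
  have "prob (E m) = (\<Prod>k=1..r. (l / m * exp (- l / m)) * (1 - exp (- l / m) ^ (nat \<lfloor>real m * w k\<rfloor> + 2)) / (1 - exp (- l / m)))"
    if m: "0 < m" for m
  proof -
    have g1: "1 \<le> g k" if "g \<in> grid_gaps w m r" "k \<in> {1..r}" for g k
      using that by (auto simp: grid_gaps_def PiE_iff)
    \<comment> \<open>Grid events that meet have equal gaps on \<open>{1..r}\<close>; extensionality
      of \<open>PiE\<close> then identifies the gap functions.\<close>
    have "disjoint_family_on (grid_event M N m r) (grid_gaps w m r)"
      unfolding disjoint_family_on_def
    proof (intro ballI impI, rule ccontr)
      fix g h assume gh: "g \<in> grid_gaps w m r" "h \<in> grid_gaps w m r" "g \<noteq> h"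
        and "grid_event M N m r g \<inter> grid_event M N m r h \<noteq> {}"
      then obtain \<omega> where "\<omega> \<in> grid_event M N m r g" "\<omega> \<in> grid_event M N m r h" by auto
      then have "g k = h k" if "k \<in> {1..r}" for k
        using grid_event_gap(1)[OF cp _ m _ that] g1 gh that by metis
      then have "g = h" using gh(1,2) unfolding grid_gaps_def by (intro PiE_ext)
      with gh(3) show False ..
    qed
    then have "prob (E m) = (\<Sum>g\<in>grid_gaps w m r. prob (grid_event M N m r g))"
      unfolding E_def using finite_grid_gaps by (intro finite_measure_finite_Union) auto
    also have "\<dots> = (\<Sum>g\<in>grid_gaps w m r. \<Prod>k=1..r. (l / m * exp (- l / m)) * exp (- l / m) ^ (g k - 1))"
      using grid[OF m] by simp
    \<comment> \<open>The gap functions range over a product set, so distributivity factors the sum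
      into geometric sums.\<close>
    also have "\<dots> = (\<Prod>k=1..r. \<Sum>y\<in>{1..nat \<lfloor>real m * w k\<rfloor> + 2}. (l / m * exp (- l / m)) * exp (- l / m) ^ (y - 1))"
      unfolding grid_gaps_def by (rule prod_sum_PiE[symmetric]) auto
    also have "\<dots> = (\<Prod>k=1..r. (l / m * exp (- l / m)) * (1 - exp (- l / m) ^ (nat \<lfloor>real m * w k\<rfloor> + 2)) / (1 - exp (- l / m)))"
    proof (rule prod.cong[OF refl])
      fix k
      have ne: "exp (- l / m) \<noteq> 1" using l m by simp
      have "(\<Sum>y\<in>{1..n}. exp (- l / m) ^ (y - 1)) = (\<Sum>y<n. exp (- l / m) ^ y)" for n
        by (rule sum.reindex_bij_witness[of _ Suc "\<lambda>y. y - 1"]) auto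
      then show "(\<Sum>y\<in>{1..nat \<lfloor>real m * w k\<rfloor> + 2}. (l / m * exp (- l / m)) * exp (- l / m) ^ (y - 1)) =
        (l / m * exp (- l / m)) * (1 - exp (- l / m) ^ (nat \<lfloor>real m * w k\<rfloor> + 2)) / (1 - exp (- l / m))"
        by (simp only: sum_distrib_left[symmetric] sum_gp_strict ne if_False times_divide_eq_right)
    qed
    finally show ?thesis .
  qed
  then have ev: "eventually (\<lambda>m. prob (E m) = (\<Prod>k=1..r. (l / m * exp (- l / m)) *
      (1 - exp (- l / m) ^ (nat \<lfloor>real m * w k\<rfloor> + 2)) / (1 - exp (- l / m)))) sequentially"
    using eventually_gt_at_top[of 0] by (rule eventually_mono[rotated])
  have "(\<lambda>m. \<Prod>k=1..r. (l / m * exp (- l / m)) * (1 - exp (- l / m) ^ (nat \<lfloor>real m * w k\<rfloor> + 2)) / (1 - exp (- l / m)))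
    \<longlonglongrightarrow> (\<Prod>k=1..r. 1 - exp (- l * w k))"
  proof (rule tendsto_prod)
    fix k assume k: "k \<in> {1..r}"
    have wk: "0 < w k" using w[OF k] .
    \<comment> \<open>The quotient of \<open>l / m * exp (- l / m)\<close> by
      \<open>1 - exp (- l / m)\<close> tends to one. The natural power appears here as a real
      exponential, whose exponent tends to \<open>- l * w k\<close>.\<close>
    have "(\<lambda>m. (l / m * exp (- l / m)) * (1 - exp (- l / m * (real_of_int \<lfloor>real m * w k\<rfloor> + 2))) / (1 - exp (- l / m)))
      \<longlonglongrightarrow> 1 - exp (- l * w k)"
      using l wk by real_asymp
    moreover have "exp (- l / m) ^ (nat \<lfloor>real m * w k\<rfloor> + 2) = exp (- l / m * (real_of_int \<lfloor>real m * w k\<rfloor> + 2))" for m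
    proof -
      have "real (nat \<lfloor>real m * w k\<rfloor> + 2) = real_of_int \<lfloor>real m * w k\<rfloor> + 2" using wk by simp
      then show ?thesis
        unfolding exp_of_nat_mult[symmetric] by (simp only: mult.commute)
    qed
    ultimately show "(\<lambda>m. (l / m * exp (- l / m)) * (1 - exp (- l / m) ^ (nat \<lfloor>real m * w k\<rfloor> + 2)) / (1 - exp (- l / m)))
      \<longlonglongrightarrow> 1 - exp (- l * w k)" by simp
  qed
  then have "(\<lambda>m. prob (E m)) \<longlonglongrightarrow> (\<Prod>k=1..r. 1 - exp (- l * w k))"
    unfolding tendsto_cong[OF ev] .
  from LIMSEQ_unique[OF lim1 this] show ?thesis by (simp add: W_def)
qed


section \<open>Auxiliary facts on products and distribution functions\<close>

text \<open>Marked cell \<open>k\<close> comes after \<open>g k - 1\<close> unmarked ones, so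
  grouping the factors into blocks that end at marked cells gives one factor per gap.\<close>

lemma prod_grid_increments:
  fixes a q :: real and g :: "nat \<Rightarrow> nat"
  assumes "\<And>k. k \<in> {1..r} \<Longrightarrow> 1 \<le> g k"
  shows "(\<Prod>j=1..\<Sum>l=1..r. g l. if j \<in> (\<lambda>k. \<Sum>l=1..k. g l) ` {1..r} then a else q) =
    (\<Prod>k=1..r. a * q ^ (g k - 1))"
  using assms
proof (induction r)
  case (Suc r)
  define i where "i = (\<lambda>k. \<Sum>l=1..k. g l)"
  have i_Suc: "i (Suc k) = i k + g (Suc k)" for k by (simp add: i_def)
  have inc: "i k < i (Suc k)" if "k \<le> r" for k using Suc.prems[of "Suc k"] that by (simp add: i_Suc)
  let ?h = "\<lambda>r j. if j \<in> i ` {1..r} then a else q"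
  have h: "?h (Suc r) j = (if j \<le> i r then ?h r j else if j = i (Suc r) then a else q)" for j
    using image_Suc_iff[of r i j, OF inc] by auto
  have split: "{1..i (Suc r)} = insert (i (Suc r)) ({1..i r} \<union> {i r<..<i (Suc r)})" using inc[of r] by auto
  have "(\<Prod>j=1..i (Suc r). ?h (Suc r) j) =
      ?h (Suc r) (i (Suc r)) * ((\<Prod>j=1..i r. ?h (Suc r) j) * (\<Prod>j\<in>{i r<..<i (Suc r)}. ?h (Suc r) j))"
    unfolding split using inc[of r] by (subst prod.insert, simp, simp, subst prod.union_disjoint) auto
  also have "?h (Suc r) (i (Suc r)) = a" by simp
  also have "(\<Prod>j=1..i r. ?h (Suc r) j) = (\<Prod>j=1..i r. ?h r j)" by (intro prod.cong refl) (subst h, simp)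
  also have "\<dots> = (\<Prod>k=1..r. a * q ^ (g k - 1))" using Suc by (simp add: i_def)
  also have "(\<Prod>j\<in>{i r<..<i (Suc r)}. ?h (Suc r) j) = (\<Prod>j\<in>{i r<..<i (Suc r)}. q)"
    by (intro prod.cong refl) (subst h, simp)
  also have "\<dots> = q ^ (g (Suc r) - 1)" by (simp add: i_Suc)
  finally show ?case by (simp add: i_def mult_ac)
qed simp

text \<open>Only countably many almost sure equalities can be combined, so distribution functions
  are first known at positive rationals. Monotonicity of \<open>F\<close> and continuity of
  \<open>h\<close> then squeeze \<open>F a\<close> between values at nearby rationals.\<close>

lemma eq_of_eq_on_rats:
  fixes F h :: "real \<Rightarrow> real"
  assumes mono: "mono F" and cont: "isCont h a" and eq: "\<And>q. 0 < q \<Longrightarrow> F (of_rat q) = h (of_rat q)"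
    and a: "0 \<le> a" and F0: "0 \<le> F 0" and h0: "h 0 = 0"
  shows "F a = h a"
proof (rule antisym; rule ccontr)
  assume "\<not> F a \<le> h a"
  then have "eventually (\<lambda>x. h x < F a) (at_right a)"
    using cont by (intro order_tendstoD(2)[where y = "h a"])
      (auto simp: continuous_at intro: tendsto_within_subset[where S = UNIV])
  then obtain b where b: "a < b" "\<And>x. a < x \<Longrightarrow> x < b \<Longrightarrow> h x < F a"
    unfolding eventually_at_right_field by auto
  obtain q where q: "a < of_rat q" "of_rat q < b" using of_rat_dense[OF b(1)] by auto
  then have "0 < real_of_rat q" using a by linarith
  then have "F (of_rat q) = h (of_rat q)" by (intro eq) simp
  moreover have "F a \<le> F (of_rat q)" using q by (intro monoD[OF mono]) simp
  ultimately show False using b(2)[of "of_rat q"] q by simp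
next
  assume lt: "\<not> h a \<le> F a"
  \<comment> \<open>No positive rational lies below \<open>a = 0\<close>; there the inequality comes
    from \<open>F0\<close> and \<open>h0\<close>.\<close>
  then have "0 < a" using a F0 h0 by (cases "a = 0") auto
  have "eventually (\<lambda>x. F a < h x) (at_left a)"
    using cont lt by (intro order_tendstoD(1)[where y = "h a"])
      (auto simp: continuous_at intro: tendsto_within_subset[where S = UNIV])
  then obtain b where b: "b < a" "\<And>x. b < x \<Longrightarrow> x < a \<Longrightarrow> F a < h x"
    unfolding eventually_at_left_field by auto
  obtain q where q: "max 0 b < of_rat q" "of_rat q < a" using of_rat_dense[of "max 0 b" a] b \<open>0 < a\<close> by auto
  then have "F (of_rat q) = h (of_rat q)" by (intro eq) simp
  moreover have "F (of_rat q) \<le> F a" using q by (intro monoD[OF mono]) simp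
  ultimately show False using b(2)[of "of_rat q"] q by simp
qed

lemma counting_process_cong:
  assumes "sets M' = sets M"
  shows "counting_process M' N \<longleftrightarrow> counting_process M N"
  unfolding counting_process_def sets_eq_imp_space_eq[OF assms] measurable_cong_sets[OF assms refl] ..

section \<open>The disintegration as conditional probability given \<open>\<Theta>\<close>\<close>

locale disintegrated_mixed_poisson = prob_space M for M :: "'a measure" +
  fixes N :: "real \<Rightarrow> 'a \<Rightarrow> enat" and \<Theta> :: "'a \<Rightarrow> real" and R :: "real \<Rightarrow> 'a measure"
  assumes counting: "counting_process M N"
    and \<Theta> [measurable]: "\<Theta> \<in> borel_measurable M"
    and mixed: "mixed_poisson_process M N \<Theta>"
    and disint: "disintegration M R (distr M borel \<Theta>)"
    and consistent: "consistent_with M R \<Theta>"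
begin

abbreviation "\<nu> \<equiv> distr M borel \<Theta>"

lemma kernel: "R \<in> borel \<rightarrow>\<^sub>M prob_algebra M"
  using disint by (simp add: disintegration_def)

lemma R_prob_space: "prob_space (R \<theta>)" and R_sets [simp]: "sets (R \<theta>) = sets M"
  using measurable_space[OF kernel, of \<theta>] by (auto simp: space_prob_algebra)

lemma R_space [simp]: "space (R \<theta>) = space M"
  using R_sets by (rule sets_eq_imp_space_eq)

lemma counting_R: "counting_process (R \<theta>) N"
  using counting unfolding counting_process_cong[OF R_sets] .

lemma measurable_R [measurable]: "A \<in> sets M \<Longrightarrow> (\<lambda>\<theta>. measure (R \<theta>) A) \<in> borel_measurable borel"
  using measurable_compose[OF measurable_prob_algebraD[OF kernel] measurable_measure_subprob_algebra] .

lemma integral_R: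
  assumes "A \<in> sets M"
  shows "(\<integral>\<theta>. measure (R \<theta>) A \<partial>\<nu>) = measure M A"
proof -
  have "(\<integral>\<theta>. measure (R \<theta>) A \<partial>\<nu>) = enn2real (\<integral>\<^sup>+\<theta>. ennreal (measure (R \<theta>) A) \<partial>\<nu>)"
    using assms by (intro integral_eq_nn_integral) auto
  also have "(\<integral>\<^sup>+\<theta>. ennreal (measure (R \<theta>) A) \<partial>\<nu>) = (\<integral>\<^sup>+\<theta>. emeasure (R \<theta>) A \<partial>\<nu>)"
    by (intro nn_integral_cong) (simp add: finite_measure.emeasure_eq_measure prob_space.finite_measure R_prob_space)
  also have "\<dots> = emeasure M A" using disint assms by (simp add: disintegration_def)
  finally show ?thesis by (simp add: measure_def)
qed

text \<open>Consistency for \<open>B\<close> concentrates \<open>R \<theta>\<close> on the preimage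
  of \<open>B\<close> when \<open>\<theta> \<in> B\<close>; consistency for the complement of
  \<open>B\<close> makes that preimage null otherwise.\<close>

lemma measure_R_Int:
  assumes A: "A \<in> sets M" and B: "B \<in> sets borel"
  shows "AE \<theta> in \<nu>. measure (R \<theta>) (A \<inter> (\<Theta> -` B \<inter> space M)) = indicat_real B \<theta> * measure (R \<theta>) A"
proof -
  have "AE \<theta> in \<nu>. \<theta> \<in> B \<longrightarrow> measure (R \<theta>) (\<Theta> -` B \<inter> space M) = 1"
    using consistent B by (simp add: consistent_with_def)
  moreover have "AE \<theta> in \<nu>. \<theta> \<in> - B \<longrightarrow> measure (R \<theta>) (\<Theta> -` (- B) \<inter> space M) = 1"
    using consistent B borel_comp[OF B] unfolding consistent_with_def by blast
  ultimately show ?thesis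
  proof eventually_elim
    case (elim \<theta>)
    interpret R: prob_space "R \<theta>" by (rule R_prob_space)
    have pre: "\<Theta> -` C \<inter> space M \<in> sets M" if "C \<in> sets borel" for C using measurable_sets[OF \<Theta> that] .
    show ?case
    proof (cases "\<theta> \<in> B")
      case True
      then have "AE \<omega> in R \<theta>. \<omega> \<in> \<Theta> -` B \<inter> space M"
        using elim(1) pre[OF B] by (subst R.prob_eq_1[symmetric]) auto
      then have "measure (R \<theta>) (A \<inter> (\<Theta> -` B \<inter> space M)) = measure (R \<theta>) A"
        using A pre[OF B] by (intro R.finite_measure_eq_AE) auto
      then show ?thesis using True by simp
    next
      case False
      then have "AE \<omega> in R \<theta>. \<omega> \<in> \<Theta> -` (- B) \<inter> space M"
        using elim(2) pre[OF borel_comp[OF B]] by (subst R.prob_eq_1[symmetric]) auto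
      then have "measure (R \<theta>) (A \<inter> (\<Theta> -` B \<inter> space M)) = measure (R \<theta>) {}"
        using A pre[OF B] by (intro R.finite_measure_eq_AE) auto
      then show ?thesis using False by simp
    qed
  qed
qed

text \<open>Every set of the sigma-algebra generated by \<open>\<Theta>\<close> is the preimage of a
  Borel set \<open>B\<close>. The integral over it becomes, under \<open>\<nu>\<close>, that of
  \<open>indicat_real B \<theta> * measure (R \<theta>) A\<close>; by \<open>measure_R_Int\<close>
  the indicator is absorbed into the event, and \<open>integral_R\<close> evaluates the
  result.\<close>

lemma cond_prob_given_eq_R:
  assumes A [measurable]: "A \<in> sets M"
  shows "AE \<omega> in M. cond_prob_given M \<Theta> A \<omega> = measure (R (\<Theta> \<omega>)) A"
proof -
  define F where "F = gen_subalgebra M \<Theta>"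
  have setsF: "sets F = {\<Theta> -` B \<inter> space M | B. B \<in> sets borel}"
    unfolding F_def gen_subalgebra_def by (rule sets_vimage_algebra2) auto
  have [measurable]: "\<Theta> \<in> borel_measurable F"
    unfolding F_def gen_subalgebra_def by (rule measurable_vimage_algebra1) auto
  have "subalgebra M F"
    unfolding subalgebra_def setsF using measurable_sets[OF \<Theta>] by (auto simp: F_def gen_subalgebra_def)
  then interpret finite_measure_subalgebra M F by unfold_locales
  have [measurable]: "(\<lambda>\<omega>. measure (R (\<Theta> \<omega>)) A) \<in> borel_measurable M" "(\<lambda>\<omega>. measure (R (\<Theta> \<omega>)) A) \<in> borel_measurable F"
    by measurable
  have R_le: "measure (R \<theta>) A \<le> 1" for \<theta> using prob_space.prob_le_1[OF R_prob_space] .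
  have "AE \<omega> in M. real_cond_exp M F (indicator A) \<omega> = measure (R (\<Theta> \<omega>)) A"
  proof (rule real_cond_exp_charact)
    fix C assume "C \<in> sets F"
    then obtain B where B [measurable]: "B \<in> sets borel" and C: "C = \<Theta> -` B \<inter> space M" by (auto simp: setsF)
    have [measurable]: "C \<in> sets M" unfolding C by measurable
    have "(\<integral>\<omega>\<in>C. measure (R (\<Theta> \<omega>)) A \<partial>M) = (\<integral>\<omega>. indicat_real B (\<Theta> \<omega>) * measure (R (\<Theta> \<omega>)) A \<partial>M)"
      unfolding set_lebesgue_integral_def by (intro Bochner_Integration.integral_cong) (auto simp: C indicator_def)
    also have "\<dots> = (\<integral>\<theta>. indicat_real B \<theta> * measure (R \<theta>) A \<partial>\<nu>)"
      by (subst integral_distr) auto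
    also have "\<dots> = (\<integral>\<theta>. measure (R \<theta>) (A \<inter> C) \<partial>\<nu>)"
      using measure_R_Int[OF A B] by (intro integral_cong_AE) (auto simp: C)
    also have "\<dots> = measure M (A \<inter> C)" by (rule integral_R) simp
    also have "\<dots> = (\<integral>\<omega>. indicat_real (A \<inter> C) \<omega> \<partial>M)" by simp
    also have "\<dots> = (\<integral>\<omega>\<in>C. indicat_real A \<omega> \<partial>M)"
      unfolding set_lebesgue_integral_def by (intro Bochner_Integration.integral_cong) (auto simp: indicator_def)
    finally show "(\<integral>\<omega>\<in>C. indicat_real A \<omega> \<partial>M) = (\<integral>\<omega>\<in>C. measure (R (\<Theta> \<omega>)) A \<partial>M)" ..
  next
    show "integrable M (indicat_real A)" by (simp add: emeasure_eq_measure)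
    show "integrable M (\<lambda>\<omega>. measure (R (\<Theta> \<omega>)) A)"
      using R_le by (intro integrable_const_bound[where B = 1]) auto
  qed simp
  then show ?thesis by (simp add: cond_prob_given_def F_def)
qed

text \<open>Carries the conditional hypotheses on \<open>N\<close>, which hold almost surely on the
  sample space, over to \<open>R \<theta>\<close> for \<open>\<nu>\<close>-almost every
  \<open>\<theta>\<close>.\<close>

lemma measure_R_eq:
  assumes [measurable]: "A \<in> sets M" "h \<in> borel_measurable borel"
    and eq: "AE \<omega> in M. cond_prob_given M \<Theta> A \<omega> = h (\<Theta> \<omega>)"
  shows "AE \<theta> in \<nu>. measure (R \<theta>) A = h \<theta>"
proof -
  have "AE \<omega> in M. measure (R (\<Theta> \<omega>)) A = h (\<Theta> \<omega>)"
    using cond_prob_given_eq_R[OF assms(1)] eq by eventually_elim simp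
  then show ?thesis by (subst AE_distr_iff) auto
qed

section \<open>Interarrival times under the measures \<open>R \<theta>\<close>\<close>

lemma \<Theta>_pos: "AE \<omega> in M. 0 < \<Theta> \<omega>"
  using mixed AE_prob_1[of "{\<omega> \<in> space M. 0 < \<Theta> \<omega>}"] by (auto simp: mixed_poisson_process_def)

lemma \<nu>_pos: "AE \<theta> in \<nu>. 0 < \<theta>"
  using \<Theta>_pos by (subst AE_distr_iff) auto

text \<open>A cell has length \<open>1 / m\<close>, so its increment is conditionally Poisson with
  rate \<open>\<Theta> \<omega> / m\<close>; almost sure positivity of \<open>\<Theta>\<close> gives
  access to the explicit point masses.\<close>

lemma cond_prob_increment:
  assumes m: "0 < m" and j: "1 \<le> j"
  shows "AE \<omega> in M. cond_prob_given M \<Theta> ((\<lambda>\<omega>. N (real j / real m) \<omega> - N (real (j - 1) / real m) \<omega>) -` {enat c} \<inter> space M) \<omega>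
    = (\<Theta> \<omega> / m) ^ c / fact c * exp (- \<Theta> \<omega> / m)"
proof -
  have t: "real (j - 1) / real m + 1 / real m = real j / real m" using m j by (simp add: field_simps of_nat_diff)
  have "0 \<le> real (j - 1) / real m" "0 < 1 / real m" using m by auto
  with mixed have "AE \<omega> in M. cond_prob_given M \<Theta> {\<omega>' \<in> space M. N (real (j - 1) / real m + 1 / real m) \<omega>' - N (real (j - 1) / real m) \<omega>' \<in> {enat c}} \<omega>
      = measure_pmf.prob (map_pmf enat (poisson_pmf (1 / real m * \<Theta> \<omega>))) {enat c}"
    unfolding mixed_poisson_process_def by blast
  with \<Theta>_pos show ?thesis
  proof eventually_elim
    case (elim \<omega>)
    have "inj enat" by (simp add: inj_def)
    then have "measure_pmf.prob (map_pmf enat (poisson_pmf (1 / real m * \<Theta> \<omega>))) {enat c} = (\<Theta> \<omega> / m) ^ c / fact c * exp (- \<Theta> \<omega> / m)"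
      using elim(1) m by (simp add: measure_pmf_single pmf_map_inj')
    moreover have "(\<lambda>\<omega>. N (real j / real m) \<omega> - N (real (j - 1) / real m) \<omega>) -` {enat c} \<inter> space M =
       {\<omega>' \<in> space M. N (real (j - 1) / real m + 1 / real m) \<omega>' - N (real (j - 1) / real m) \<omega>' \<in> {enat c}}"
      unfolding t by auto
    ultimately show ?case using elim(2) by (simp only:)
  qed
qed

text \<open>Conditional independence splits the pattern into single cells. A marked cell contributes
  the Poisson mass at one, any other cell the mass at zero, and \<open>prod_grid_increments\<close>
  collects these factors by gaps.\<close>

lemma measure_R_grid_event:
  assumes r: "1 \<le> r" and m: "0 < m" and g: "\<And>k. k \<in> {1..r} \<Longrightarrow> 1 \<le> g k"
  shows "AE \<theta> in \<nu>. measure (R \<theta>) (grid_event M N m r g) =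
    (\<Prod>k=1..r. (\<theta> / m * exp (- \<theta> / m)) * exp (- \<theta> / m) ^ (g k - 1))"
proof (rule measure_R_eq)
  show "grid_event M N m r g \<in> sets M" by (rule grid_event_sets[OF counting])
  define n where "n = (\<Sum>l=1..r. g l)"
  define I where "I = (\<lambda>k. \<Sum>l=1..k. g l) ` {1..r}"
  define X where "X = (\<lambda>j \<omega>. N (real j / real m) \<omega> - N (real (j - 1) / real m) \<omega>)"
  define B where "B j = {enat (if j \<in> I then 1 else 0)}" for j
  \<comment> \<open>Conditional independence is stated for nonempty index sets; the last gap
    guarantees at least one cell.\<close>
  have "g r \<le> n" unfolding n_def using r by (intro member_le_sum) auto
  then have n: "1 \<le> n" using g[of r] r by simp
  have grid: "grid_event M N m r g = (\<Inter>j\<in>{1..n}. X j -` B j \<inter> space M)"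
    using n unfolding grid_event_def n_def[symmetric] I_def[symmetric]
    by (auto simp: X_def B_def one_enat_def zero_enat_def)
  have "strict_mono_on {0..n} (\<lambda>j. real j / real m)" using m by (auto intro!: strict_mono_onI divide_strict_right_mono)
  moreover have "cond_indep_increments M N \<Theta>" using mixed by (simp add: mixed_poisson_process_def)
  ultimately have "cond_indep_vars M \<Theta> (\<lambda>_. count_space UNIV) X {1..n}"
    unfolding cond_indep_increments_def X_def
    by (elim allE[of _ n] allE[of _ "\<lambda>j. real j / real m"] impE) auto
  then have "AE \<omega> in M. cond_prob_given M \<Theta> (\<Inter>j\<in>{1..n}. X j -` B j \<inter> space M) \<omega> =
      (\<Prod>j\<in>{1..n}. cond_prob_given M \<Theta> (X j -` B j \<inter> space M) \<omega>)"
    unfolding cond_indep_vars_def using n by auto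
  moreover have "AE \<omega> in M. \<forall>j\<in>{1..n}. cond_prob_given M \<Theta> (X j -` B j \<inter> space M) \<omega> =
      (if j \<in> I then \<Theta> \<omega> / m * exp (- \<Theta> \<omega> / m) else exp (- \<Theta> \<omega> / m))"
  proof (rule AE_finite_allI)
    fix j assume "j \<in> {1..n}"
    then show "AE \<omega> in M. cond_prob_given M \<Theta> (X j -` B j \<inter> space M) \<omega> =
      (if j \<in> I then \<Theta> \<omega> / m * exp (- \<Theta> \<omega> / m) else exp (- \<Theta> \<omega> / m))"
      using cond_prob_increment[OF m, of j "if j \<in> I then 1 else 0"] by (auto simp: X_def B_def)
  qed simp
  ultimately show "AE \<omega> in M. cond_prob_given M \<Theta> (grid_event M N m r g) \<omega> =
    (\<Prod>k=1..r. (\<Theta> \<omega> / m * exp (- \<Theta> \<omega> / m)) * exp (- \<Theta> \<omega> / m) ^ (g k - 1))"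
  proof eventually_elim
    case (elim \<omega>)
    have "cond_prob_given M \<Theta> (grid_event M N m r g) \<omega> =
      (\<Prod>j=1..n. if j \<in> I then \<Theta> \<omega> / m * exp (- \<Theta> \<omega> / m) else exp (- \<Theta> \<omega> / m))"
      unfolding grid elim(1) using elim(2) by (intro prod.cong refl) blast
    then show ?case unfolding n_def I_def using g by (subst (asm) prod_grid_increments) auto
  qed
qed measurable

text \<open>There are countably many meshes with finitely many gap functions each, so one null set
  serves all grid identities; outside it the limit is taken under a fixed
  \<open>R \<theta>\<close>.\<close>

lemma measure_R_interarrivals:
  assumes r: "1 \<le> r" and w: "\<And>k. k \<in> {1..r} \<Longrightarrow> 0 < w k"
  shows "AE \<theta> in \<nu>. measure (R \<theta>) {\<omega> \<in> space M. \<forall>k\<in>{1..r}. interarrival N k \<omega> \<le> w k} =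
    (\<Prod>k=1..r. 1 - exp (- \<theta> * w k))"
proof -
  have "AE \<theta> in \<nu>. \<forall>m. \<forall>g\<in>grid_gaps w (Suc m) r. measure (R \<theta>) (grid_event M N (Suc m) r g) =
    (\<Prod>k=1..r. (\<theta> / Suc m * exp (- \<theta> / Suc m)) * exp (- \<theta> / Suc m) ^ (g k - 1))"
    unfolding AE_all_countable
    by (intro allI AE_finite_allI finite_grid_gaps measure_R_grid_event r) (auto simp: grid_gaps_def PiE_iff)
  with \<nu>_pos show ?thesis
  proof eventually_elim
    case (elim \<theta>)
    interpret R: prob_space "R \<theta>" by (rule R_prob_space)
    have "R.prob (grid_event (R \<theta>) N m r g) = (\<Prod>k=1..r. (\<theta> / m * exp (- \<theta> / m)) * exp (- \<theta> / m) ^ (g k - 1))"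
      if "0 < m" "g \<in> grid_gaps w m r" for m g
      using elim(2)[rule_format, of g "m - 1"] that by (simp add: grid_event_def)
    then show ?case using R.prob_interarrival_le[OF counting_R, of \<theta> r w] elim(1) w by simp
  qed
qed

text \<open>The marginal arises from the joint law of the first \<open>k\<close> interarrival times
  by letting the other bounds grow through the positive integers; their factors tend to one because
  \<open>\<theta>\<close> is positive.\<close>

lemma measure_R_interarrival:
  assumes k: "1 \<le> k" and w: "0 < w"
  shows "AE \<theta> in \<nu>. measure (R \<theta>) {\<omega> \<in> space M. interarrival N k \<omega> \<le> w} = 1 - exp (- \<theta> * w)"
proof -
  define v where "v n j = (if j = k then w else real (Suc n))" for n j
  have "AE \<theta> in \<nu>. \<forall>n. measure (R \<theta>) {\<omega> \<in> space M. \<forall>j\<in>{1..k}. interarrival N j \<omega> \<le> v n j} =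
    (\<Prod>j=1..k. 1 - exp (- \<theta> * v n j))"
    unfolding AE_all_countable using w k by (intro allI measure_R_interarrivals) (auto simp: v_def)
  with \<nu>_pos show ?thesis
  proof eventually_elim
    case (elim \<theta>)
    interpret R: prob_space "R \<theta>" by (rule R_prob_space)
    define E where "E n = {\<omega> \<in> space M. \<forall>j\<in>{1..k}. interarrival N j \<omega> \<le> v n j}" for n
    note [measurable] = measurable_interarrival[OF counting]
    have "E n \<in> sets M" for n unfolding E_def by measurable
    moreover have "incseq E" by (intro incseq_SucI) (force simp: E_def v_def)
    ultimately have "(\<lambda>n. R.prob (E n)) \<longlonglongrightarrow> R.prob (\<Union>n. E n)" by (intro R.finite_Lim_measure_incseq) auto
    also have "(\<Union>n. E n) = {\<omega> \<in> space M. interarrival N k \<omega> \<le> w}"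
    proof (intro set_eqI iffI)
      fix \<omega> assume "\<omega> \<in> {\<omega> \<in> space M. interarrival N k \<omega> \<le> w}"
      then have \<omega>: "\<omega> \<in> space M" "interarrival N k \<omega> \<le> w" by auto
      have "eventually (\<lambda>n. c \<le> real (Suc n)) sequentially" for c by real_asymp
      then have "eventually (\<lambda>n. \<forall>j\<in>{1..k}. interarrival N j \<omega> \<le> real (Suc n)) sequentially"
        by (intro eventually_ball_finite ballI) auto
      then obtain n where "\<forall>j\<in>{1..k}. interarrival N j \<omega> \<le> real (Suc n)"
        using eventually_happens by fastforce
      then have "\<omega> \<in> E n" using \<omega> by (auto simp: E_def v_def)
      then show "\<omega> \<in> (\<Union>n. E n)" by auto
    qed (use k in \<open>auto simp: E_def v_def dest: bspec[of _ _ k]\<close>)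
    finally have lim: "(\<lambda>n. R.prob (E n)) \<longlonglongrightarrow> R.prob {\<omega> \<in> space M. interarrival N k \<omega> \<le> w}" .
    have "(\<lambda>n. \<Prod>j=1..k. 1 - exp (- \<theta> * v n j)) \<longlonglongrightarrow> (\<Prod>j=1..k. if j = k then 1 - exp (- \<theta> * w) else 1)"
    proof (rule tendsto_prod)
      fix j
      have "(\<lambda>n. 1 - exp (- \<theta> * real (Suc n))) \<longlonglongrightarrow> 1" using elim(1) by real_asymp
      then show "(\<lambda>n. 1 - exp (- \<theta> * v n j)) \<longlonglongrightarrow> (if j = k then 1 - exp (- \<theta> * w) else 1)"
        by (simp add: v_def)
    qed
    then have "(\<lambda>n. R.prob (E n)) \<longlonglongrightarrow> 1 - exp (- \<theta> * w)" using elim(2) k by (simp add: E_def)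
    with lim show ?case by (rule LIMSEQ_unique)
  qed
qed

text \<open>A single null set covers all indices and all positive rational bounds; outside it
  \<open>eq_of_eq_on_rats\<close> reaches every nonnegative bound.\<close>

lemma distributed_interarrival:
  "AE \<theta> in \<nu>. \<forall>n\<ge>1. distributed (R \<theta>) lborel (interarrival N n) (exponential_density (if 0 < \<theta> then \<theta> else 1))"
proof -
  have "AE \<theta> in \<nu>. \<forall>n q. 1 \<le> n \<longrightarrow> 0 < q \<longrightarrow>
    measure (R \<theta>) {\<omega> \<in> space M. interarrival N n \<omega> \<le> real_of_rat q} = 1 - exp (- \<theta> * real_of_rat q)"
    unfolding AE_all_countable using measure_R_interarrival by (auto intro!: allI AE_impI)
  with \<nu>_pos show ?thesis
  proof eventually_elim
    case (elim \<theta>)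
    interpret R: prob_space "R \<theta>" by (rule R_prob_space)
    note [measurable] = measurable_interarrival[OF counting_R]
    have sets: "{\<omega> \<in> space (R \<theta>). interarrival N n \<omega> \<le> a} \<in> R.events" for n a by measurable
    show ?case
    proof (intro allI impI)
      fix n :: nat assume n: "1 \<le> n"
      have "R.prob {\<omega> \<in> space (R \<theta>). interarrival N n \<omega> \<le> a} = 1 - exp (- a * \<theta>)" if "0 \<le> a" for a
      proof (rule eq_of_eq_on_rats[OF _ _ _ that, where F = "\<lambda>a. R.prob {\<omega> \<in> space (R \<theta>). interarrival N n \<omega> \<le> a}"])
        show "mono (\<lambda>a. R.prob {\<omega> \<in> space (R \<theta>). interarrival N n \<omega> \<le> a})"
          by (intro monoI R.finite_measure_mono sets) auto
      qed (use elim n in \<open>auto simp: mult.commute intro!: continuous_intros\<close>)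
      then show "distributed (R \<theta>) lborel (interarrival N n) (exponential_density (if 0 < \<theta> then \<theta> else 1))"
        using elim(1) by (simp add: R.exponential_distributed_iff)
    qed
  qed
qed

text \<open>For \<open>\<nu>\<close>-almost every \<open>\<theta>\<close> the joint distribution
  function and the product of the marginals have the same exponential form; integrating over
  \<open>\<nu>\<close> turns the former into the probability under \<open>M\<close>.\<close>

lemma huang_mrp: "huang_mrp M N R \<nu>"
  unfolding huang_mrp_def
proof (intro conjI allI impI)
  show "prob_space \<nu>" by (rule prob_space_distr) measurable
next
  fix r :: nat and w :: "nat \<Rightarrow> real"
  assume r: "1 \<le> r" and w: "\<forall>k\<in>{1..r}. 0 < w k"
  note [measurable] = measurable_interarrival[OF counting]
  let ?E = "{\<omega> \<in> space M. \<forall>k\<in>{1..r}. interarrival N k \<omega> \<le> w k}"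
  have [measurable]: "?E \<in> sets M" "{\<omega> \<in> space M. interarrival N k \<omega> \<le> w k} \<in> sets M" for k by measurable
  have "AE \<theta> in \<nu>. \<forall>k\<in>{1..r}. measure (R \<theta>) {\<omega> \<in> space M. interarrival N k \<omega> \<le> w k} = 1 - exp (- \<theta> * w k)"
    using w by (intro AE_finite_allI measure_R_interarrival) auto
  moreover have "AE \<theta> in \<nu>. measure (R \<theta>) ?E = (\<Prod>k=1..r. 1 - exp (- \<theta> * w k))"
    using w r by (intro measure_R_interarrivals) auto
  ultimately have "AE \<theta> in \<nu>. measure (R \<theta>) ?E = (\<Prod>k=1..r. measure (R \<theta>) {\<omega> \<in> space M. interarrival N k \<omega> \<le> w k})"
    by eventually_elim simp
  then have "(\<integral>\<theta>. measure (R \<theta>) ?E \<partial>\<nu>) = (\<integral>\<theta>. (\<Prod>k=1..r. measure (R \<theta>) {\<omega> \<in> space M. interarrival N k \<omega> \<le> w k}) \<partial>\<nu>)"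
    by (intro integral_cong_AE) auto
  moreover have "(\<Inter>k\<in>{1..r}. {\<omega> \<in> space M. interarrival N k \<omega> \<le> w k}) = ?E" using r by auto
  ultimately show "measure M (\<Inter>k\<in>{1..r}. {\<omega> \<in> space M. interarrival N k \<omega> \<le> w k}) =
      (\<integral>y. (\<Prod>k\<in>{1..r}. measure (R y) {\<omega> \<in> space M. interarrival N k \<omega> \<le> w k}) \<partial>\<nu>)"
    using integral_R[of ?E] by simp
qed (use kernel in auto)

end

theorem proposition2p2:
  fixes M :: "'a measure"
    and N :: "real \<Rightarrow> 'a \<Rightarrow> enat"
    and \<Theta> :: "'a \<Rightarrow> real"
    and R :: "real \<Rightarrow> 'a measure"
  assumes "prob_space M"
    and "counting_process M N"
    and "\<Theta> \<in> borel_measurable M"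
    and "mixed_poisson_process M N \<Theta>"
    and "disintegration M R (distr M borel \<Theta>)"
    and "consistent_with M R \<Theta>"
  shows "huang_mpp M N R (distr M borel \<Theta>)"
proof -
  interpret disintegrated_mixed_poisson M N \<Theta> R
    using assms by (intro disintegrated_mixed_poisson.intro disintegrated_mixed_poisson_axioms.intro)
  show ?thesis
    unfolding huang_mpp_def
    \<comment> \<open>The rate is \<open>\<theta>\<close> itself on the positive half-line, which
      has full \<open>\<nu>\<close>-measure; the value \<open>1\<close> elsewhere keeps it positive
      everywhere.\<close>
    by (intro conjI huang_mrp exI[of _ "\<lambda>\<theta>. if 0 < \<theta> then \<theta> else 1"] distributed_interarrival) auto
qed

end
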